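(* Let the model assumptions (A) described in the context hold. Let $x\in[0,1]$, $h>0$, let $n=n(h,x)=|\{k\in\{1,\dots,N\}:k/N\in[x-h,x+h]\}|$, let $J(\beta)\in\mathbb N$ be a constant depending only on $\beta$, and for $j=1,\dots,2J(\beta)$ put $$\mathcal I_j=\big[-1+(j-1)/J(\beta),\,-1+j/J(\beta)\big],\qquad Z_j(h,x)=\min\Big\{\tilde\varepsilon_k:\ 1\le k\le N,\ \tfrac kN\in x+h\mathcal I_j\Big\},$$ where $\tilde\varepsilon_k=\varepsilon_k/X_{k-1}$. Suppose that $v=v_n>0$ satisfies $v=o\big(n^{\frac1{1+\mathfrak a}}\big)$. Then $$\mathbb P\Big(\max_{1\le j\le 2J(\beta)}\big\{Z_j(h,x):x+h\mathcal I_j\subseteq[0,1]\big\}\ge n^{-1/\mathfrak a}v\Big)\lesssim e^{-\mathfrak c^{(1)}v^{\mathfrak a}}$$ for some constant $\mathfrak c^{(1)}\in(0,\infty)$.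
   Context: $a_n\lesssim b_n$ means that there are $c\in(0,\infty)$, $n_0\in\mathbb N$ with $a_n\le c\,b_n$ for all $n\ge n_0$. **Hölder class.** For $\beta>0$ put $\langle\beta\rangle=\max\{m\in\mathbb N_0: m<\beta\}$. $f\in\mathcal H(L,\beta)$ means that $f$ is $\langle\beta\rangle$ times differentiable and $|f^{(\langle\beta\rangle)}(y)-f^{(\langle\beta\rangle)}(z)|\le L|y-z|^{\beta-\langle\beta\rangle}$ for all $y,z$ in the domain of the function ($[0,1]$ for the coefficient function $f$; $[0,\infty)$ for $F_\varepsilon$ below). **Model assumptions (A).** Fix $L,\beta>0$, $\rho\in(0,1)$, $\mathfrak a,\mathfrak c,\mathfrak c_g,\delta\in(0,\infty)$, $L_\varepsilon,\beta_\varepsilon>0$. The coefficient function $f:[0,1]\to[0,\rho]$ lies in $\mathcal H(L,\beta)$ and is extended to $\mathbb R$ by $f(u)=f(0)$ for $u<0$ and $f(u)=f(1)$ for $u>1$. The innovations $(\varepsilon_k)_{k\in\mathbb Z}$ are i.i.d. with distribution function $F_\varepsilon$ such that (i) as $y\downarrow0$, $F_\varepsilon(y)=\mathfrak c\,y^{\mathfrak a}+g(y)$ with $|g(y)|\le\mathfrak c_g\,y^{\mathfrak a+\delta}$ (so $\varepsilon_k\ge0$ a.s.), and $F_\varepsilon\in\mathcal H(L_\varepsilon,\beta_\varepsilon)$; (ii) $\mathbb E\varepsilon_1^p<\infty$ for $p=\max\{1,2\mathfrak a+\delta\}$. For $N\in\mathbb N$ the process satisfies $X_k=f(k/N)X_{k-1}+\varepsilon_k$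 and is defined for all $k\in\mathbb Z$ by $X_k=\sum_{i\ge0}\big(\prod_{l=0}^{i-1}f(\tfrac{k-l}{N})\big)\varepsilon_{k-i}$. *)

theory Defs
  imports "HOL-Probability.Probability" "HOL-Library.Landau_Symbols"
begin

definition hoelder_order :: "real \<Rightarrow> nat" where
  "hoelder_order \<beta> = Max {m::nat. real m < \<beta>}"

text \<open>
  Here \<open>D m\<close> is the \<open>m\<close>-th derivative of \<open>f\<close>.  Derivatives are taken within the domain \<open>S\<close>,
  so they are one-sided at the boundary points of \<open>S\<close>.
\<close>

definition hoelder_class :: "real set \<Rightarrow> real \<Rightarrow> real \<Rightarrow> (real \<Rightarrow> real) set" where
  "hoelder_class S L \<beta> = {f. \<exists>D :: nat \<Rightarrow> real \<Rightarrow> real.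
     (\<forall>y\<in>S. D 0 y = f y) \<and>
     (\<forall>m<hoelder_order \<beta>. \<forall>y\<in>S. (D m has_real_derivative D (Suc m) y) (at y within S)) \<and>
     (\<forall>y\<in>S. \<forall>z\<in>S. \<bar>D (hoelder_order \<beta>) y - D (hoelder_order \<beta>) z\<bar>
        \<le> L * \<bar>y - z\<bar> powr (\<beta> - real (hoelder_order \<beta>)))}"

definition extend_const :: "(real \<Rightarrow> real) \<Rightarrow> real \<Rightarrow> real" where
  "extend_const f u = (if u < 0 then f 0 else if u > 1 then f 1 else f u)"

definition ar_process ::
    "(real \<Rightarrow> real) \<Rightarrow> (int \<Rightarrow> 'a \<Rightarrow> real) \<Rightarrow> nat \<Rightarrow> int \<Rightarrow> 'a \<Rightarrow> real" where
  "ar_process f \<epsilon> N k \<omega> =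
     (\<Sum>i. (\<Prod>l<i. extend_const f (real_of_int (k - int l) / real N)) * \<epsilon> (k - int i) \<omega>)"

definition num_obs :: "nat \<Rightarrow> real \<Rightarrow> real \<Rightarrow> nat" where
  "num_obs N h x = card {k\<in>{1..N}. real k / real N \<in> {x - h..x + h}}"

text \<open>The set \<open>x + h I\<^sub>j\<close>, where \<open>I\<^sub>j = [-1 + (j - 1) / J, -1 + j / J]\<close>.\<close>

definition block :: "nat \<Rightarrow> real \<Rightarrow> real \<Rightarrow> nat \<Rightarrow> real set" where
  "block J h x j = (\<lambda>u. x + h * u) ` {- 1 + (real j - 1) / real J .. - 1 + real j / real J}"

definition scaled_innov ::
    "(real \<Rightarrow> real) \<Rightarrow> (int \<Rightarrow> 'a \<Rightarrow> real) \<Rightarrow> nat \<Rightarrow> int \<Rightarrow> 'a \<Rightarrow> real" where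
  "scaled_innov f \<epsilon> N k \<omega> = \<epsilon> k \<omega> / ar_process f \<epsilon> N (k - 1) \<omega>"

text \<open>
  The minimum and the maximum over finite index sets are taken in \<^typ>\<open>ereal\<close>, so that the
  minimum over the empty set is \<open>\<infinity>\<close> and the maximum over the empty set is \<open>-\<infinity>\<close>.
\<close>

definition block_min ::
    "(real \<Rightarrow> real) \<Rightarrow> (int \<Rightarrow> 'a \<Rightarrow> real) \<Rightarrow> nat \<Rightarrow> nat \<Rightarrow> real \<Rightarrow> real \<Rightarrow> nat \<Rightarrow> 'a \<Rightarrow> ereal" where
  "block_min f \<epsilon> N J h x j \<omega> =
     (INF k\<in>{k\<in>{1..N}. real k / real N \<in> block J h x j}. ereal (scaled_innov f \<epsilon> N (int k) \<omega>))"

definition max_block_min ::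
    "(real \<Rightarrow> real) \<Rightarrow> (int \<Rightarrow> 'a \<Rightarrow> real) \<Rightarrow> nat \<Rightarrow> nat \<Rightarrow> real \<Rightarrow> real \<Rightarrow> 'a \<Rightarrow> ereal" where
  "max_block_min f \<epsilon> N J h x \<omega> =
     (SUP j\<in>{j\<in>{1..2 * J}. block J h x j \<subseteq> {0..1}}. block_min f \<epsilon> N J h x j \<omega>)"

end

theory Submission
  imports Defs
begin

text \<open>
  Almost surely \<open>X\<^sub>k\<^sub>-\<^sub>1 \<ge> \<epsilon>\<^sub>k\<^sub>-\<^sub>1 \<ge> 0\<close>, so \<open>\<epsilon>\<^sub>k / X\<^sub>k\<^sub>-\<^sub>1 \<ge> t\<close> forces \<open>\<epsilon>\<^sub>k \<ge> t \<epsilon>\<^sub>k\<^sub>-\<^sub>1\<close>.  For even \<open>k\<close>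
  these events are independent, and each of them fails with probability at least
  \<open>F (t b) (1 - F b)\<close>, which is at least of the order of \<open>t\<^sup>\<aa>\<close> for a small fixed \<open>b\<close>.  A block contains at
  least a fixed proportion of the \<open>n\<close> observations, so that with \<open>t\<^sup>\<aa> = v\<^sup>\<aa> / n\<close> the probability
  that none of them fails is at most \<open>exp (- c v\<^sup>\<aa>)\<close>.
\<close>

section \<open>Power law of the distribution function at zero\<close>

lemma power_law_lower_bound:
  fixes F g :: "real \<Rightarrow> real"
  assumes "c > 0" "d > 0"
    and "eventually (\<lambda>y. F y = c * y powr a + g y \<and> \<bar>g y\<bar> \<le> C * y powr (a + d)) (at_right 0)"
  shows "eventually (\<lambda>y. F y \<ge> c / 2 * y powr a) (at_right 0)"
proof -
  \<comment> \<open>Relative to \<open>y powr a\<close> the remainder has size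
    \<open>C * y powr d\<close>, which vanishes at 0 and so eventually costs at most half of the
    leading coefficient.\<close>
  have "((\<lambda>y::real. C * y powr d) \<longlongrightarrow> C * 0) (at_right 0)"
    using assms(2) by (intro tendsto_mult tendsto_const tendsto_powr'[THEN tendsto_eq_rhs, of _ 0 _ _ d])
      (auto intro!: tendsto_eq_intros eventually_at_right_less[THEN eventually_mono]
        simp: less_imp_le)
  then have "eventually (\<lambda>y. C * y powr d < c / 2) (at_right (0::real))"
    using assms(1) by (intro order_tendstoD(2)[of _ 0]) auto
  with assms(3) eventually_at_right_less[of 0] show ?thesis
  proof eventually_elim
    case (elim y)
    have "C * y powr (a + d) = (C * y powr d) * y powr a"
      by (simp add: powr_add)
    also have "\<dots> \<le> c / 2 * y powr a"
      using elim by (intro mult_right_mono) auto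
    finally show ?case using elim by (auto simp: abs_le_iff)
  qed
qed

text \<open>Both terms of the expansion carry a positive exponent. The limit later yields
  \<open>F 0 = 0\<close> and a level \<open>b > 0\<close> with \<open>F b < 1\<close>.\<close>

lemma power_law_tendsto_0:
  fixes F g :: "real \<Rightarrow> real"
  assumes "a > 0" "d > 0"
    and "eventually (\<lambda>y. F y = c * y powr a + g y \<and> \<bar>g y\<bar> \<le> C * y powr (a + d)) (at_right 0)"
  shows "(F \<longlongrightarrow> 0) (at_right 0)"
proof -
  have P: "((\<lambda>y::real. y powr r) \<longlongrightarrow> 0) (at_right 0)" if "r > 0" for r
    using that by (intro tendsto_powr'[THEN tendsto_eq_rhs, of _ 0 _ _ r])
      (auto intro!: tendsto_eq_intros eventually_at_right_less[THEN eventually_mono]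
        simp: less_imp_le)
  have "((\<lambda>y. \<bar>c\<bar> * y powr a + C * y powr (a + d)) \<longlongrightarrow> \<bar>c\<bar> * 0 + C * 0) (at_right 0)"
    using assms(1,2) by (intro tendsto_intros P) auto
  then have "((\<lambda>y. \<bar>c\<bar> * y powr a + C * y powr (a + d)) \<longlongrightarrow> 0) (at_right 0)" by simp
  moreover have "eventually (\<lambda>y. norm (F y) \<le> \<bar>c\<bar> * y powr a + C * y powr (a + d)) (at_right 0)"
    using assms(3)
  proof eventually_elim
    case (elim y)
    have "\<bar>F y\<bar> \<le> \<bar>c * y powr a\<bar> + \<bar>g y\<bar>" using elim by linarith
    then show ?case using elim by (simp add: abs_mult)
  qed
  ultimately show ?thesis by (rule Lim_null_comparison[rotated])
qed

text \<open>An expansion valid for positive \<open>y\<close> says nothing about the value at 0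
  itself; right-continuity closes this gap.\<close>

lemma (in finite_borel_measure) cdf_eq_lim_at_right:
  assumes "(cdf M \<longlongrightarrow> l) (at_right x)"
  shows "cdf M x = l"
  using cdf_is_right_cont[of x] assms
  by (intro tendsto_unique[of "at_right x" "cdf M"]) (auto simp: continuous_within)

section \<open>Counting observations in the window and in a block\<close>

lemma num_obs_le:
  assumes "N \<ge> 1" "h \<ge> 0"
  shows "real (num_obs N h x) \<le> 2 * h * real N + 1"
proof -
  let ?A = "{k\<in>{1..N}. real k / real N \<in> {x - h..x + h}}"
  \<comment> \<open>The observations are integers in an interval of length \<open>2 * h * N\<close>.
    Later the bound is read backwards: a large \<open>n\<close> forces a large
    \<open>N * h\<close>.\<close>
  have "int ` ?A \<subseteq> {\<lceil>(x - h) * N\<rceil>..\<lfloor>(x + h) * N\<rfloor>}"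
    using assms by (auto simp: field_simps ceiling_le_iff le_floor_iff)
  then have "card (int ` ?A) \<le> card {\<lceil>(x - h) * N\<rceil>..\<lfloor>(x + h) * N\<rfloor>}"
    by (intro card_mono) auto
  then have "num_obs N h x \<le> nat (\<lfloor>(x + h) * N\<rfloor> - \<lceil>(x - h) * N\<rceil> + 1)"
    by (simp add: num_obs_def card_image)
  moreover have "real_of_int (\<lfloor>(x + h) * N\<rfloor> - \<lceil>(x - h) * N\<rceil> + 1) \<le> 2 * h * real N + 1"
  proof -
    have "real_of_int (\<lfloor>(x + h) * N\<rfloor> - \<lceil>(x - h) * N\<rceil> + 1) \<le> (x + h) * N - (x - h) * N + 1"
      using of_int_floor_le[of "(x + h) * N"] le_of_int_ceiling[of "(x - h) * N"]
      unfolding of_int_add of_int_diff of_int_1 by linarith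
    then show ?thesis by (simp add: algebra_simps)
  qed
  moreover have "0 \<le> 2 * h * real N + 1" using assms by simp
  ultimately show ?thesis by linarith
qed

lemma block_eq:
  assumes "h > 0" "J \<ge> 1"
  shows "block J h x j = {x + h * (- 1 + (real j - 1) / real J) .. x + h * (- 1 + real j / real J)}"
  using assms unfolding block_def
  by (subst image_affinity_atLeastAtMost[of h x, folded add.commute[of x]])
     (auto simp: divide_right_mono)

text \<open>Even positions are kept so that the pairs \<open>2 * i - 1\<close>, \<open>2 * i\<close>
  are disjoint for different \<open>i\<close>. A block has length \<open>h / J\<close> and even
  positions are spaced \<open>2 / N\<close> apart; the \<open>- 1\<close> absorbs the rounding. The
  partner \<open>2 * i - 1\<close> may lie outside the block.\<close>

lemma block_even_indices:
  assumes "N \<ge> 1" "h > 0" "J \<ge> 1" "block J h x j \<subseteq> {0..1}"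
  obtains I :: "nat set" where "finite I"
    "\<And>i. i \<in> I \<Longrightarrow> 2 * i \<in> {1..N} \<and> real (2 * i) / real N \<in> block J h x j"
    "real (card I) \<ge> real N * h / (2 * real J) - 1"
proof -
  define p where "p = x + h * (- 1 + (real j - 1) / real J)"
  define q where "q = x + h * (- 1 + real j / real J)"
  have b: "block J h x j = {p..q}" using block_eq[OF assms(2,3)] by (simp add: p_def q_def)
  have qp: "q - p = h / real J"
    using assms by (simp add: p_def q_def field_simps)
  then have "p \<le> q" using assms by (smt (verit) divide_nonneg_nonneg of_nat_0_le_iff)
  then have pq: "0 \<le> p" "q \<le> 1" using assms(4) unfolding b by auto
  \<comment> \<open>Open on the left, so that \<open>i\<close> starts at 1 even if
    \<open>p = 0\<close>, and the cardinality is a difference of floors.\<close>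
  define I where "I = {nat \<lfloor>real N * p / 2\<rfloor> <.. nat \<lfloor>real N * q / 2\<rfloor>}"
  show thesis
  proof
    show "finite I" by (simp add: I_def)
  next
    fix i assume "i \<in> I"
    then have i: "\<lfloor>real N * p / 2\<rfloor> < int i" "int i \<le> \<lfloor>real N * q / 2\<rfloor>" "i \<ge> 1"
      by (auto simp: I_def)
    then have "real N * p / 2 < real i" "real i \<le> real N * q / 2"
      by linarith+
    then have *: "real N * p < real (2 * i)" "real (2 * i) \<le> real N * q" by auto
    moreover have "real N * q \<le> real N" using pq assms by (simp add: mult_left_le)
    ultimately have "2 * i \<le> N" by linarith
    moreover have "p \<le> real (2 * i) / real N" "real (2 * i) / real N \<le> q"
      using * assms(1) by (auto simp: field_simps)
    ultimately show "2 * i \<in> {1..N} \<and> real (2 * i) / real N \<in> block J h x j"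
      using i b by auto
  next
    have "\<lfloor>real N * q / 2\<rfloor> - \<lfloor>real N * p / 2\<rfloor> \<le> int (card I)"
    proof -
      have "\<lfloor>real N * p / 2\<rfloor> \<ge> 0" using pq by simp
      then show ?thesis unfolding I_def card_greaterThanAtMost by linarith
    qed
    then have "real (card I) \<ge> real_of_int (\<lfloor>real N * q / 2\<rfloor> - \<lfloor>real N * p / 2\<rfloor>)"
      by linarith
    moreover have "real_of_int (\<lfloor>real N * q / 2\<rfloor> - \<lfloor>real N * p / 2\<rfloor>) \<ge> real N * q / 2 - real N * p / 2 - 1"
      by linarith
    moreover have "real N * q / 2 - real N * p / 2 = real N * h / (2 * real J)"
    proof -
      have "real N * q / 2 - real N * p / 2 = real N * (q - p) / 2"
        by (simp add: field_simps)
      then show ?thesis by (simp add: qp)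
    qed
    ultimately show "real (card I) \<ge> real N * h / (2 * real J) - 1" by linarith
  qed
qed

section \<open>Pathwise reduction to pairs of consecutive innovations\<close>

lemma max_block_min_geD:
  assumes "max_block_min f \<epsilon> N J h x \<omega> \<ge> ereal t"
  obtains j where "j \<in> {1..2 * J}" "block J h x j \<subseteq> {0..1}"
    "\<And>k. k \<in> {1..N} \<Longrightarrow> real k / real N \<in> block J h x j \<Longrightarrow> scaled_innov f \<epsilon> N (int k) \<omega> \<ge> t"
proof -
  define S where "S = {j\<in>{1..2 * J}. block J h x j \<subseteq> {0..1}}"
  have "finite S" by (simp add: S_def)
  have le: "ereal t \<le> (SUP j\<in>S. block_min f \<epsilon> N J h x j \<omega>)"
    using assms by (simp add: max_block_min_def S_def)
  \<comment> \<open>The supremum over no blocks is \<open>-\<infinity>\<close>, below every real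
    threshold. Hence some block lies in the unit interval, and over finitely many blocks the
    supremum is attained.\<close>
  then have "S \<noteq> {}" by (auto simp: bot_ereal_def)
  with \<open>finite S\<close> have "(SUP j\<in>S. block_min f \<epsilon> N J h x j \<omega>) \<in> (\<lambda>j. block_min f \<epsilon> N J h x j \<omega>) ` S"
    by (metis Max_Sup Max_in finite_imageI image_is_empty)
  then obtain j where j: "j \<in> S" "ereal t \<le> block_min f \<epsilon> N J h x j \<omega>" using le by auto
  show thesis
  proof
    show "j \<in> {1..2 * J}" "block J h x j \<subseteq> {0..1}" using j by (auto simp: S_def)
    fix k assume "k \<in> {1..N}" "real k / real N \<in> block J h x j"
    then have "ereal t \<le> ereal (scaled_innov f \<epsilon> N (int k) \<omega>)"
      using j(2) by (intro order_trans[OF j(2)]) (auto simp: block_min_def intro!: INF_lower)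
    then show "scaled_innov f \<epsilon> N (int k) \<omega> \<ge> t" by simp
  qed
qed

lemma extend_const_range:
  assumes "f \<in> {0..1} \<rightarrow> {0..\<rho>}"
  shows "extend_const f u \<in> {0..\<rho>}"
  using assms by (auto simp: extend_const_def Pi_iff)

text \<open>All terms of the series are nonnegative and the one with \<open>i = 0\<close> is the
  innovation itself. Domination by the weights \<open>\<rho> ^ i\<close> secures convergence,
  without which the value of the infinite sum would be unspecified.\<close>

lemma ar_process_ge_innov:
  assumes f: "f \<in> {0..1} \<rightarrow> {0..\<rho>}"
    and nonneg: "\<And>i. \<epsilon> (k - int i) \<omega> \<ge> 0"
    and summ: "summable (\<lambda>i. \<rho> ^ i * \<epsilon> (k - int i) \<omega>)"
  shows "ar_process f \<epsilon> N k \<omega> \<ge> \<epsilon> k \<omega>"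
proof -
  define w where "w i = (\<Prod>l<i. extend_const f (real_of_int (k - int l) / real N))" for i
  have w: "0 \<le> w i" "w i \<le> \<rho> ^ i" for i
  proof -
    show "0 \<le> w i" using extend_const_range[OF f] by (auto simp: w_def intro!: prod_nonneg)
    have "w i \<le> (\<Prod>l<i. \<rho>)"
      unfolding w_def using extend_const_range[OF f] by (intro prod_mono) auto
    then show "w i \<le> \<rho> ^ i" by simp
  qed
  have "summable (\<lambda>i. w i * \<epsilon> (k - int i) \<omega>)"
    by (rule summable_comparison_test'[OF summ, of 0]) (use w nonneg in \<open>auto intro!: mult_right_mono\<close>)
  from sum_le_suminf[OF this, of "{0}"] show ?thesis
    using w nonneg by (simp add: ar_process_def w_def)
qed

text \<open>Bounding the denominator below by the previous innovation replaces dependence on the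
  whole past by a condition on two innovations.\<close>

lemma scaled_innov_geD:
  assumes "f \<in> {0..1} \<rightarrow> {0..\<rho>}" "t > 0"
    and "\<And>k. \<epsilon> k \<omega> \<ge> 0"
    and "summable (\<lambda>i. \<rho> ^ i * \<epsilon> (k - 1 - int i) \<omega>)"
    and "scaled_innov f \<epsilon> N k \<omega> \<ge> t"
  shows "\<epsilon> k \<omega> \<ge> t * \<epsilon> (k - 1) \<omega>"
proof -
  let ?X = "ar_process f \<epsilon> N (k - 1) \<omega>"
  have X: "?X \<ge> \<epsilon> (k - 1) \<omega>"
    using assms by (intro ar_process_ge_innov[where \<rho>=\<rho>]) auto
  with assms(3)[of "k - 1"] have "?X \<ge> 0" by linarith
  moreover have "?X \<noteq> 0" \<comment> \<open>since \<open>\<epsilon> k \<omega> / 0 = 0 < t\<close>\<close>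
    using assms(2,5) by (auto simp: scaled_innov_def)
  ultimately have "t * ?X \<le> \<epsilon> k \<omega>" using assms(5) by (auto simp: scaled_innov_def field_simps)
  moreover have "t * \<epsilon> (k - 1) \<omega> \<le> t * ?X" using X assms(2) by simp
  ultimately show ?thesis by linarith
qed

section \<open>Convergence of the series, and independence of disjoint pairs\<close>

context prob_space
begin

text \<open>By Tonelli the expected sum of absolute values is a geometric series times the first
  absolute moment of \<open>Z\<close>, hence finite, so the sum itself is finite almost
  surely.\<close>

lemma AE_summable_geometric:
  fixes Y :: "nat \<Rightarrow> 'a \<Rightarrow> real"
  assumes Y: "\<And>i. Y i \<in> borel_measurable M" and Z: "integrable M Z"
    and ident: "\<And>i. distr M borel (Y i) = distr M borel Z"
    and \<rho>: "0 \<le> \<rho>" "\<rho> < 1"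
  shows "AE \<omega> in M. summable (\<lambda>i. \<rho> ^ i * Y i \<omega>)"
proof -
  note [measurable] = Y borel_measurable_integrable[OF Z]
  have "(\<integral>\<^sup>+\<omega>. ennreal \<bar>Y i \<omega>\<bar> \<partial>M) = (\<integral>\<^sup>+\<omega>. ennreal \<bar>Z \<omega>\<bar> \<partial>M)" for i
    using nn_integral_distr[of "Y i" M borel "\<lambda>y. ennreal \<bar>y\<bar>"]
      nn_integral_distr[of Z M borel "\<lambda>y. ennreal \<bar>y\<bar>"] ident[of i] by simp
  also have "(\<integral>\<^sup>+\<omega>. ennreal \<bar>Z \<omega>\<bar> \<partial>M) = ennreal (\<integral>\<omega>. \<bar>Z \<omega>\<bar> \<partial>M)"
    using Z by (intro nn_integral_eq_integral) auto
  finally have E: "(\<integral>\<^sup>+\<omega>. ennreal \<bar>Y i \<omega>\<bar> \<partial>M) = ennreal (\<integral>\<omega>. \<bar>Z \<omega>\<bar> \<partial>M)" for i .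
  have "(\<integral>\<^sup>+\<omega>. (\<Sum>i. ennreal (\<rho> ^ i * \<bar>Y i \<omega>\<bar>)) \<partial>M) = (\<Sum>i. \<integral>\<^sup>+\<omega>. ennreal (\<rho> ^ i * \<bar>Y i \<omega>\<bar>) \<partial>M)"
    by (intro nn_integral_suminf) measurable
  also have "\<dots> = (\<Sum>i. ennreal (\<rho> ^ i * (\<integral>\<omega>. \<bar>Z \<omega>\<bar> \<partial>M)))"
    using \<rho> by (intro suminf_cong) (simp add: ennreal_mult nn_integral_cmult E)
  also have "\<dots> = ennreal (\<Sum>i. \<rho> ^ i * (\<integral>\<omega>. \<bar>Z \<omega>\<bar> \<partial>M))"
    using \<rho> by (intro suminf_ennreal2) (auto intro!: summable_mult2 summable_geometric)
  finally have "(\<integral>\<^sup>+\<omega>. (\<Sum>i. ennreal (\<rho> ^ i * \<bar>Y i \<omega>\<bar>)) \<partial>M) \<noteq> \<infinity>" by simp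
  then have "AE \<omega> in M. (\<Sum>i. ennreal (\<rho> ^ i * \<bar>Y i \<omega>\<bar>)) \<noteq> \<infinity>"
    by (rule nn_integral_PInf_AE[rotated]) measurable
  then show ?thesis
  proof eventually_elim
    case (elim \<omega>)
    then have "summable (\<lambda>i. \<rho> ^ i * \<bar>Y i \<omega>\<bar>)"
      using \<rho> by (intro summable_suminf_not_top) auto
    then show ?case
      by (rule summable_comparison_test'[of _ 0]) (use \<rho> in \<open>simp add: abs_mult\<close>)
  qed
qed

text \<open>For \<open>y \<ge> 0\<close> and \<open>p \<ge> 1\<close> one has
  \<open>y \<le> 1 + y powr p\<close>.\<close>

lemma integrable_of_integrable_powr:
  fixes X :: "'a \<Rightarrow> real"
  assumes "X \<in> borel_measurable M" "AE \<omega> in M. X \<omega> \<ge> 0" "p \<ge> 1"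
    and "integrable M (\<lambda>\<omega>. X \<omega> powr p)"
  shows "integrable M X"
proof (rule Bochner_Integration.integrable_bound)
  show "integrable M (\<lambda>\<omega>. 1 + X \<omega> powr p)" using assms by simp
  show "AE \<omega> in M. norm (X \<omega>) \<le> norm (1 + X \<omega> powr p)"
    using assms(2)
  proof eventually_elim
    case (elim \<omega>)
    show ?case
    proof (cases "X \<omega> \<le> 1")
      case True
      then show ?thesis using elim by (simp add: add_increasing2)
    next
      case False
      then have "X \<omega> powr 1 \<le> X \<omega> powr p" using assms by (intro powr_mono) auto
      then show ?thesis using False by simp
    qed
  qed
qed (use assms in auto)

text \<open>Where \<open>X > b\<close> and \<open>Y \<le> t * b\<close>, also
  \<open>Y < t * X\<close>; independence factorises the probability of this part of the complement.
  The level \<open>b\<close> is free here and stays fixed later, while \<open>t\<close> tends to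
  0.\<close>

lemma prob_ratio_ge_le:
  fixes X Y :: "'a \<Rightarrow> real"
  assumes ind: "indep_var borel X borel Y" and "t > 0"
  shows "prob {\<omega> \<in> space M. Y \<omega> \<ge> t * X \<omega>}
    \<le> 1 - cdf (distr M borel Y) (t * b) * (1 - cdf (distr M borel X) b)"
proof -
  have [measurable]: "X \<in> borel_measurable M" "Y \<in> borel_measurable M"
    using indep_var_rv1[OF ind] indep_var_rv2[OF ind] by auto
  have "prob {\<omega> \<in> space M. X \<omega> > b} * prob {\<omega> \<in> space M. Y \<omega> \<le> t * b}
    = prob {\<omega> \<in> space M. X \<omega> > b \<and> Y \<omega> \<le> t * b}"
    using indep_varD[OF ind, of "{b<..}" "{..t * b}"]
    by (auto simp: vimage_def Int_def conj_commute conj_left_commute)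
  also have "\<dots> \<le> prob {\<omega> \<in> space M. \<not> (Y \<omega> \<ge> t * X \<omega>)}"
    using \<open>t > 0\<close> by (intro finite_measure_mono) (auto simp: not_le intro: le_less_trans)
  also have "\<dots> = 1 - prob {\<omega> \<in> space M. Y \<omega> \<ge> t * X \<omega>}"
    by (rule prob_neg) measurable
  finally have "prob {\<omega> \<in> space M. X \<omega> > b} * prob {\<omega> \<in> space M. Y \<omega> \<le> t * b}
    \<le> 1 - prob {\<omega> \<in> space M. Y \<omega> \<ge> t * X \<omega>}" .
  moreover have "prob {\<omega> \<in> space M. X \<omega> > b} = 1 - cdf (distr M borel X) b"
  proof -
    have "prob {\<omega> \<in> space M. \<not> X \<omega> \<le> b} = 1 - prob {\<omega> \<in> space M. X \<omega> \<le> b}"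
      by (rule prob_neg) measurable
    then show ?thesis
      by (simp add: cdf_def measure_distr not_le vimage_def Int_def conj_commute)
  qed
  moreover have "prob {\<omega> \<in> space M. Y \<omega> \<le> t * b} = cdf (distr M borel Y) (t * b)"
    by (simp add: cdf_def measure_distr vimage_def Int_def conj_commute)
  ultimately show ?thesis by (simp add: mult.commute)
qed

lemma indep_vars_imp_indep_var:
  assumes "indep_vars M' X I" "i \<in> I" "j \<in> I" "i \<noteq> j"
  shows "indep_var (M' i) (X i) (M' j) (X j)"
proof -
  have "indep_var (PiM {i} M') (\<lambda>\<omega>. restrict (\<lambda>k. X k \<omega>) {i}) (PiM {j} M') (\<lambda>\<omega>. restrict (\<lambda>k. X k \<omega>) {j})"
    using assms by (intro indep_var_restrict) auto
  then have "indep_var (M' i) ((\<lambda>y. y i) \<circ> (\<lambda>\<omega>. restrict (\<lambda>k. X k \<omega>) {i}))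
      (M' j) ((\<lambda>y. y j) \<circ> (\<lambda>\<omega>. restrict (\<lambda>k. X k \<omega>) {j}))"
    by (rule indep_var_compose) auto
  then show ?thesis by (simp add: comp_def)
qed

text \<open>Different \<open>i\<close> use disjoint pairs of innovations, so the events are
  independent and the one-pair bound is raised to a power. The separate \<open>q\<close> leaves room
  for an exponential form of that bound.\<close>

lemma prob_all_even_ratios_ge_le:
  fixes \<epsilon> :: "int \<Rightarrow> 'a \<Rightarrow> real"
  assumes ind: "indep_vars (\<lambda>_. borel) \<epsilon> UNIV"
    and ident: "\<And>k. distr M borel (\<epsilon> k) = D"
    and "t > 0" "finite I" "1 - cdf D (t * b) * (1 - cdf D b) \<le> q"
  shows "prob {\<omega> \<in> space M. \<forall>i\<in>I. \<epsilon> (int (2 * i)) \<omega> \<ge> t * \<epsilon> (int (2 * i) - 1) \<omega>} \<le> q ^ card I"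
\<comment> \<open>The product rule for independent families is applied to a nonempty index set; for
  the empty one the bound is \<open>q ^ 0 = 1\<close>.\<close>
proof (cases "I = {}")
  case False
  define K where "K i = {int (2 * i), int (2 * i) - 1}" for i :: nat
  have [measurable]: "\<epsilon> k \<in> borel_measurable M" for k
    using ind by (auto simp: indep_vars_def)
  have "disjoint_family_on K I"
    unfolding disjoint_family_on_def K_def by (auto; presburger)
  then have "indep_vars (\<lambda>i. PiM (K i) (\<lambda>_. borel)) (\<lambda>i \<omega>. restrict (\<lambda>k. \<epsilon> k \<omega>) (K i)) I"
    using ind by (intro indep_vars_restrict) auto
  \<comment> \<open>Each event is recast as a difference lying in \<open>{0..}\<close>, a measurable
    function of its own group of coordinates.\<close>
  then have "indep_vars (\<lambda>_. borel)
      (\<lambda>i \<omega>. (\<lambda>y. y (int (2 * i)) - t * y (int (2 * i) - 1)) (restrict (\<lambda>k. \<epsilon> k \<omega>) (K i))) I"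
    by (rule indep_vars_compose2) (auto simp: K_def intro!: borel_measurable_diff borel_measurable_times)
  then have "indep_vars (\<lambda>_. borel) (\<lambda>i \<omega>. \<epsilon> (int (2 * i)) \<omega> - t * \<epsilon> (int (2 * i) - 1) \<omega>) I"
    by (simp add: K_def)
  from indep_varsD[OF this False \<open>finite I\<close> subset_refl, of "\<lambda>_. {0..}"]
  have "prob (\<Inter>i\<in>I. {\<omega> \<in> space M. \<epsilon> (int (2 * i)) \<omega> \<ge> t * \<epsilon> (int (2 * i) - 1) \<omega>})
    = (\<Prod>i\<in>I. prob {\<omega> \<in> space M. \<epsilon> (int (2 * i)) \<omega> \<ge> t * \<epsilon> (int (2 * i) - 1) \<omega>})"
    by (simp add: vimage_def Int_def conj_commute)
  also have "\<dots> \<le> (\<Prod>i\<in>I. q)"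
  proof (intro prod_mono conjI)
    fix i
    have "indep_var borel (\<epsilon> (int (2 * i) - 1)) borel (\<epsilon> (int (2 * i)))"
      by (intro indep_vars_imp_indep_var[OF ind]) auto
    from prob_ratio_ge_le[OF this \<open>t > 0\<close>, of b] assms(5)
    show "prob {\<omega> \<in> space M. \<epsilon> (int (2 * i)) \<omega> \<ge> t * \<epsilon> (int (2 * i) - 1) \<omega>} \<le> q"
      by (simp add: ident)
  qed auto
  also have "(\<Inter>i\<in>I. {\<omega> \<in> space M. \<epsilon> (int (2 * i)) \<omega> \<ge> t * \<epsilon> (int (2 * i) - 1) \<omega>})
    = {\<omega> \<in> space M. \<forall>i\<in>I. \<epsilon> (int (2 * i)) \<omega> \<ge> t * \<epsilon> (int (2 * i) - 1) \<omega>}"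
    using False by auto
  finally show ?thesis by simp
qed simp

end

text \<open>The constants are chosen before \<open>N\<close>, \<open>x\<close> and \<open>h\<close>,
  so the bound is uniform in them. In the proof \<open>\<cc>1\<close> and \<open>C\<close> come from
  the law of the innovations and \<open>J \<beta>\<close>; \<open>v\<close> enters only the
  threshold \<open>n\<^sub>0\<close>.\<close>

theorem theorem3p6:
  fixes M :: "'a measure"
    and \<epsilon> :: "int \<Rightarrow> 'a \<Rightarrow> real"
    and f g F :: "real \<Rightarrow> real"
    and L \<beta> \<rho> \<aa> \<cc> \<cc>\<^sub>g \<delta> L\<^sub>\<epsilon> \<beta>\<^sub>\<epsilon> :: real
    and J :: "real \<Rightarrow> nat"
    and v :: "nat \<Rightarrow> real"
  assumes "L > 0" and "\<beta> > 0" and "0 < \<rho>" and "\<rho> < 1"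
    and "\<aa> > 0" and "\<cc> > 0" and "\<cc>\<^sub>g > 0" and "\<delta> > 0" and "L\<^sub>\<epsilon> > 0" and "\<beta>\<^sub>\<epsilon> > 0"
    and f_range: "f \<in> {0..1} \<rightarrow> {0..\<rho>}"
    and f_hoelder: "f \<in> hoelder_class {0..1} L \<beta>"
    and prob: "prob_space M"
    and indep: "prob_space.indep_vars M (\<lambda>_. borel) \<epsilon> UNIV"
    and ident: "\<And>k. distr M borel (\<epsilon> k) = distr M borel (\<epsilon> 1)"
    and F_def: "F = cdf (distr M borel (\<epsilon> 1))"
    and F_expansion: "eventually (\<lambda>y. F y = \<cc> * y powr \<aa> + g y \<and> \<bar>g y\<bar> \<le> \<cc>\<^sub>g * y powr (\<aa> + \<delta>)) (at_right 0)"
    and F_hoelder: "F \<in> hoelder_class {0..} L\<^sub>\<epsilon> \<beta>\<^sub>\<epsilon>"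
    and moment: "integrable M (\<lambda>\<omega>. \<epsilon> 1 \<omega> powr (max 1 (2 * \<aa> + \<delta>)))"
    and J_pos: "J \<beta> \<ge> 1"
    and v_pos: "\<And>n. v n > 0"
    and v_small: "v \<in> o(\<lambda>n. real n powr (1 / (1 + \<aa>)))"
  shows "\<exists>\<cc>1 > 0. \<exists>C > 0. \<exists>n\<^sub>0. \<forall>N \<ge> 1. \<forall>x \<in> {0..1}. \<forall>h > 0. \<forall>n.
           n = num_obs N h x \<longrightarrow> n \<ge> n\<^sub>0 \<longrightarrow>
           measure M {\<omega> \<in> space M.
               max_block_min f \<epsilon> N (J \<beta>) h x \<omega> \<ge> ereal (real n powr (- 1 / \<aa>) * v n)}
             \<le> C * exp (- \<cc>1 * v n powr \<aa>)"
proof -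
  interpret prob_space M by (rule prob)
  have rv [measurable]: "\<epsilon> k \<in> borel_measurable M" for k
    using indep by (auto simp: indep_vars_def)
  define D where "D = distr M borel (\<epsilon> 1)"
  have ident': "distr M borel (\<epsilon> k) = D" for k
    using ident[of k] by (simp add: D_def)
  interpret D: real_distribution D
    unfolding D_def by (rule real_distribution_distr) (rule rv)
  have F: "F = cdf D" by (simp add: F_def D_def)
  have F_lim: "(F \<longlongrightarrow> 0) (at_right 0)"
    by (rule power_law_tendsto_0[OF \<open>\<aa> > 0\<close> \<open>\<delta> > 0\<close> F_expansion])
  have "cdf D 0 = 0"
    using F_lim unfolding F by (rule D.cdf_eq_lim_at_right)
  have AE_pos: "AE \<omega> in M. \<epsilon> k \<omega> > 0" for k
  proof -
    have "prob {\<omega> \<in> space M. \<epsilon> k \<omega> \<le> 0} = cdf (distr M borel (\<epsilon> k)) 0"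
      by (simp add: cdf_def measure_distr vimage_def Int_def conj_commute)
    then have "prob {\<omega> \<in> space M. \<epsilon> k \<omega> \<le> 0} = 0"
      by (simp only: ident' \<open>cdf D 0 = 0\<close>)
    moreover have "{\<omega> \<in> space M. \<epsilon> k \<omega> \<le> 0} \<in> events" by measurable
    ultimately have "AE \<omega> in M. \<omega> \<notin> {\<omega> \<in> space M. \<epsilon> k \<omega> \<le> 0}"
      using prob_eq_0 by blast
    with AE_space show ?thesis by eventually_elim auto
  qed
  \<comment> \<open>The moment exponent is at least 1, so the first moment is finite, which makes
    the series of the process converge almost surely.\<close>
  have "integrable M (\<epsilon> 1)"
    using AE_pos[of 1] by (intro integrable_of_integrable_powr[OF _ _ _ moment]) (auto elim: eventually_mono)
  then have AE_sum: "AE \<omega> in M. summable (\<lambda>i. \<rho> ^ i * \<epsilon> (k - int i) \<omega>)" for k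
    using \<open>0 < \<rho>\<close> \<open>\<rho> < 1\<close> by (intro AE_summable_geometric) (auto simp: ident')
  \<comment> \<open>There are countably many \<open>k\<close>, so one null set serves them
    all.\<close>
  have good: "AE \<omega> in M. (\<forall>k. \<epsilon> k \<omega> > 0) \<and> (\<forall>k. summable (\<lambda>i. \<rho> ^ i * \<epsilon> (k - int i) \<omega>))"
    using AE_pos AE_sum by (simp add: AE_all_countable)

  \<comment> \<open>A level \<open>b\<close>, independent of \<open>n\<close>, that an innovation
    exceeds with positive probability \<open>1 - F b\<close>.\<close>
  have "eventually (\<lambda>b. F b < 1 \<and> 0 < b) (at_right 0)"
    using order_tendstoD(2)[OF F_lim, of 1] eventually_at_right_less[of 0]
    by (auto intro: eventually_conj)
  then obtain b where b: "F b < 1" "0 < b"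
    using eventually_happens'[OF trivial_limit_at_right_real] by blast
  obtain \<eta> where \<eta>: "\<eta> > 0" "\<And>y. 0 < y \<Longrightarrow> y < \<eta> \<Longrightarrow> F y \<ge> \<cc> / 2 * y powr \<aa>"
    using power_law_lower_bound[OF \<open>\<cc> > 0\<close> \<open>\<delta> > 0\<close> F_expansion]
    unfolding eventually_at_right_field by auto

  define t where "t n = real n powr (- 1 / \<aa>) * v n" for n
  \<comment> \<open>The growth condition enters here: eventually
    \<open>v n \<le> n powr (1 / (1 + \<aa>))\<close>, and
    \<open>1 / (1 + \<aa>) < 1 / \<aa>\<close>, so \<open>t n\<close> tends to 0 and
    \<open>t n * b\<close> falls into the range of the power-law bound.\<close>
  have "eventually (\<lambda>n. t n * b < \<eta>) sequentially"
  proof -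
    have "1 / (1 + \<aa>) < 1 / \<aa>"
      using \<open>\<aa> > 0\<close> by (intro divide_strict_left_mono) auto
    then have "- 1 / \<aa> + 1 / (1 + \<aa>) < 0" by simp
    then have "((\<lambda>n. real n powr (- 1 / \<aa> + 1 / (1 + \<aa>))) \<longlongrightarrow> 0) sequentially"
      by (intro tendsto_neg_powr filterlim_real_sequentially)
    moreover have "\<eta> / b > 0" using \<eta> b by simp
    ultimately have "eventually (\<lambda>n. real n powr (- 1 / \<aa> + 1 / (1 + \<aa>)) < \<eta> / b) sequentially"
      by (rule order_tendstoD)
    moreover have "eventually (\<lambda>n. norm (v n) \<le> 1 * norm (real n powr (1 / (1 + \<aa>)))) sequentially"
      using v_small by (rule landau_o.smallD) simp
    ultimately show ?thesis
    proof eventually_elim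
      case (elim n)
      have "t n \<le> real n powr (- 1 / \<aa>) * real n powr (1 / (1 + \<aa>))"
        using elim(2) unfolding t_def by (intro mult_left_mono) auto
      also have "\<dots> = real n powr (- 1 / \<aa> + 1 / (1 + \<aa>))"
        by (rule powr_add[symmetric])
      finally have "t n < \<eta> / b" using elim(1) by linarith
      then show ?case using b by (simp add: field_simps)
    qed
  qed
  then obtain n1 where n1: "\<And>n. n \<ge> n1 \<Longrightarrow> t n * b < \<eta>"
    by (auto simp: eventually_sequentially)

  define m where "m = J \<beta>"
  have m: "m \<ge> 1" using J_pos by (simp add: m_def)
  \<comment> \<open>The product of \<open>\<cc> / 2\<close> from the power-law bound, the share
    \<open>1 / (8 * m)\<close> of usable indices, and the factors coming from
    \<open>b\<close>.\<close>
  define c1 where "c1 = \<cc> / (16 * real m) * b powr \<aa> * (1 - F b)"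
  have c1: "c1 > 0" using \<open>\<cc> > 0\<close> m b by (simp add: c1_def)

  have "measure M {\<omega> \<in> space M. max_block_min f \<epsilon> N (J \<beta>) h x \<omega> \<ge> ereal (real n powr (- 1 / \<aa>) * v n)}
      \<le> 2 * real m * exp (- c1 * v n powr \<aa>)"
    if N: "1 \<le> N" and h: "0 < h" and n: "n = num_obs N h x" "max n1 (8 * m + 2) \<le> n" for N x h n
  proof -
    have n_pos: "real n > 0" using n(2) by simp
    have t: "t n > 0" "t n * b < \<eta>" using n_pos v_pos[of n] n1[of n] n(2) by (auto simp: t_def)
    \<comment> \<open>A lower bound for the probability that one pair violates the ratio condition.
      It is of order \<open>v n powr \<aa> / n\<close>, so that \<open>n / (8 * m)\<close> pairs
      contribute exactly \<open>c1 * v n powr \<aa>\<close>.\<close>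
    define s where "s = \<cc> / 2 * (t n * b) powr \<aa> * (1 - F b)"
    have s: "F (t n * b) * (1 - F b) \<ge> s"
      unfolding s_def using \<eta>(2)[of "t n * b"] t b by (intro mult_right_mono) auto
    have "(t n * b) powr \<aa> = v n powr \<aa> * b powr \<aa> / real n"
    proof -
      have "(real n powr (- 1 / \<aa>)) powr \<aa> = real n powr (- 1)"
        unfolding powr_powr using \<open>\<aa> > 0\<close> by simp
      then have "(real n powr (- 1 / \<aa>)) powr \<aa> = 1 / real n"
        using n_pos by (simp only: powr_minus_divide) simp
      then show ?thesis
        using b v_pos[of n] by (simp add: t_def powr_mult)
    qed
    then have sn: "s * (real n / (8 * real m)) = c1 * v n powr \<aa>"
      using n_pos m by (simp add: s_def c1_def field_simps)
    have "s > 0" using \<open>\<cc> > 0\<close> t b by (simp add: s_def)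

    define S where "S = {j\<in>{1..2 * m}. block m h x j \<subseteq> {0..1}}"
    have "\<exists>I. finite I \<and> (\<forall>i\<in>I. 2 * i \<in> {1..N} \<and> real (2 * i) / real N \<in> block m h x j)
        \<and> real n / (8 * real m) \<le> real (card I)" if "j \<in> S" for j
    proof -
      have sub: "block m h x j \<subseteq> {0..1}" using that by (simp add: S_def)
      obtain I where I: "finite I" "\<And>i. i \<in> I \<Longrightarrow> 2 * i \<in> {1..N} \<and> real (2 * i) / real N \<in> block m h x j"
        "real (card I) \<ge> real N * h / (2 * real m) - 1"
        by (rule block_even_indices[OF N h m sub]) auto
      have "real n \<le> 2 * h * real N + 1"
        unfolding n(1) using N h by (intro num_obs_le) auto
      moreover have "real n \<ge> 8 * real m + 2" using n(2) by simp
      \<comment> \<open>The count gives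
        \<open>N * h / (2 * m) - 1 \<ge> (n - 1) / (4 * m) - 1\<close>, and this is at least
        \<open>n / (8 * m)\<close> exactly when \<open>n \<ge> 8 * m + 2\<close>, whence that
        threshold.\<close>
      ultimately have "real n / (8 * real m) \<le> real N * h / (2 * real m) - 1"
        using m by (simp add: field_simps)
      with I(3) have "real n / (8 * real m) \<le> real (card I)" by linarith
      with I(1,2) show ?thesis by blast
    qed
    then obtain I where I: "\<And>j. j \<in> S \<Longrightarrow> finite (I j)"
        "\<And>j i. j \<in> S \<Longrightarrow> i \<in> I j \<Longrightarrow> 2 * i \<in> {1..N} \<and> real (2 * i) / real N \<in> block m h x j"
        "\<And>j. j \<in> S \<Longrightarrow> real n / (8 * real m) \<le> real (card (I j))"
      by metis
    define B where "B j = {\<omega> \<in> space M. \<forall>i\<in>I j. \<epsilon> (int (2 * i)) \<omega> \<ge> t n * \<epsilon> (int (2 * i) - 1) \<omega>}" for j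
    have B_meas: "B j \<in> events" if "j \<in> S" for j
      unfolding B_def using I(1)[OF that] by measurable
    have B: "prob (B j) \<le> exp (- c1 * v n powr \<aa>)" if j: "j \<in> S" for j
    proof -
      have "prob (B j) \<le> exp (- s) ^ card (I j)"
        unfolding B_def
      proof (rule prob_all_even_ratios_ge_le[OF indep ident' t(1) I(1)[OF j]])
        \<comment> \<open>Uses \<open>1 - s \<le> exp (- s)\<close>.\<close>
        show "1 - cdf D (t n * b) * (1 - cdf D b) \<le> exp (- s)"
          using s exp_ge_add_one_self[of "- s"] by (simp add: F)
      qed
      also have "\<dots> = exp (- (s * real (card (I j))))"
        by (simp add: exp_of_nat_mult[symmetric] mult.commute)
      also have "\<dots> \<le> exp (- (s * (real n / (8 * real m))))"
        using mult_left_mono[OF I(3)[OF j], of s] \<open>s > 0\<close> by simp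
      finally show ?thesis unfolding sn by simp
    qed

    let ?A = "{\<omega> \<in> space M. max_block_min f \<epsilon> N (J \<beta>) h x \<omega> \<ge> ereal (real n powr (- 1 / \<aa>) * v n)}"
    have "AE \<omega> in M. \<omega> \<in> ?A \<longrightarrow> \<omega> \<in> (\<Union>j\<in>S. B j)"
      using good
    proof eventually_elim
      case (elim \<omega>)
      show ?case
      proof
        assume A: "\<omega> \<in> ?A"
        then have "max_block_min f \<epsilon> N m h x \<omega> \<ge> ereal (t n)" by (simp add: t_def m_def)
        then obtain j where j: "j \<in> {1..2 * m}" "block m h x j \<subseteq> {0..1}"
          "\<And>k. k \<in> {1..N} \<Longrightarrow> real k / real N \<in> block m h x j \<Longrightarrow> scaled_innov f \<epsilon> N (int k) \<omega> \<ge> t n"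
          by (rule max_block_min_geD) blast
        then have "j \<in> S" by (simp add: S_def)
        moreover have "\<omega> \<in> B j"
          unfolding B_def
        proof (intro CollectI conjI ballI)
          fix i assume "i \<in> I j"
          with I(2)[OF \<open>j \<in> S\<close>] j(3) have "scaled_innov f \<epsilon> N (int (2 * i)) \<omega> \<ge> t n" by blast
          then show "t n * \<epsilon> (int (2 * i) - 1) \<omega> \<le> \<epsilon> (int (2 * i)) \<omega>"
            using elim by (intro scaled_innov_geD[OF f_range t(1)]) (auto intro: less_imp_le)
        qed (use A in auto)
        ultimately show "\<omega> \<in> (\<Union>j\<in>S. B j)" by blast
      qed
    qed
    \<comment> \<open>Inclusion outside a null set suffices to compare the measures; measurability
      is checked for the union of the \<open>B j\<close>.\<close>
    then have "prob ?A \<le> prob (\<Union>j\<in>S. B j)"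
      using B_meas by (intro finite_measure_mono_AE sets.finite_UN) (auto simp: S_def)
    \<comment> \<open>The union bound over at most \<open>2 * m\<close> blocks produces the constant
      \<open>C\<close>.\<close>
    also have "\<dots> \<le> (\<Sum>j\<in>S. prob (B j))"
      using B_meas by (intro finite_measure_subadditive_finite) (auto simp: S_def)
    also have "\<dots> \<le> real (card S) * exp (- c1 * v n powr \<aa>)"
      using B by (intro sum_bounded_above) auto
    also have "\<dots> \<le> 2 * real m * exp (- c1 * v n powr \<aa>)"
    proof (intro mult_right_mono)
      have "card S \<le> card {1..2 * m}" unfolding S_def by (intro card_mono) auto
      then show "real (card S) \<le> 2 * real m" by simp
    qed simp
    finally show ?thesis .
  qed
  moreover have "2 * real m > 0" using m by simp
  ultimately show ?thesis using c1 by blast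
qed

end
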